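(* Let $u\ge 2$ be an integer, let $X \subseteq \{2,\ldots,u\}$ and let $|X| = m$. Suppose we are given a data structure that, for any string $S$ of length $n$ and any query set $Q$ of size $q\ge 2$ with parameter $d$, supports $\mathsf{lmco}_{S,Q}$- or $\mathsf{co}_{S,Q}$-queries in $f_t(n,q,d)$ time using $f_s(n,q,d)$ space. Then we obtain a data structure that supports predecessor queries on $X$ (i.e. given $x$, return $\max\{y\in X\mid y\le x\}$, or report that none exists) in $O(f_t(2u^2, 2, 8m))$ time using $O(f_s(2u^2, 2, 8m))$ space.
   Context: Word RAM model with logarithmic word size. For a string $S$ of length $n$ over alphabet $\Sigma$ and $Q\subseteq\Sigma$ with $|Q|=q\ge2$: an interval $[i,j]\subseteq[1,n]$ is a co-occurrence if $S[i..j]$ contains every character of $Q$ at least once; it is left-minimal if $[i+1,j]$ is not a co-occurrence. $\mathsf{co}_{S,Q}(w)$ is the number of co-occurrences of length $w$ (length of $[i,j]$ is $j-i+1$), $\mathsf{lmco}_{S,Q}(w)$ the number of left-minimal co-occurrences of length $w$. With $\delta(i)=\mathsf{lmco}(i)-\mathsf{lmco}(i-1)$ for $i\in[2,n]$, the parameter $d$ is the number of $i\in[2,n]$ with $\delta(i)\neq0$.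
   Formalization: The bounds f_t and f_s are additionally assumed nondecreasing in d; without this the claim fails, e.g. for u=2, X={2}, where n=8 and 8m=8 but always d≤7, so f_t(8,2,8) is unconstrained and could be 0. *)

theory Defs
  imports Complex_Main "HOL-Library.Landau_Symbols"
begin

section \<open>Co-occurrences\<close>

text \<open>Positions in a string are numbered from 1.\<close>

definition substring :: "'a list \<Rightarrow> nat \<Rightarrow> nat \<Rightarrow> 'a list" where
  "substring S i j = take (j + 1 - i) (drop (i - 1) S)"

definition co_occurrence :: "'a list \<Rightarrow> 'a set \<Rightarrow> nat \<Rightarrow> nat \<Rightarrow> bool" where
  "co_occurrence S Q i j \<longleftrightarrow>
     1 \<le> i \<and> i \<le> j \<and> j \<le> length S \<and> Q \<subseteq> set (substring S i j)"

definition left_minimal_co_occurrence :: "'a list \<Rightarrow> 'a set \<Rightarrow> nat \<Rightarrow> nat \<Rightarrow> bool" where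
  "left_minimal_co_occurrence S Q i j \<longleftrightarrow>
     co_occurrence S Q i j \<and> \<not> co_occurrence S Q (i + 1) j"

definition co :: "'a list \<Rightarrow> 'a set \<Rightarrow> nat \<Rightarrow> nat" where
  "co S Q w = card {(i, j). co_occurrence S Q i j \<and> j - i + 1 = w}"

definition lmco :: "'a list \<Rightarrow> 'a set \<Rightarrow> nat \<Rightarrow> nat" where
  "lmco S Q w = card {(i, j). left_minimal_co_occurrence S Q i j \<and> j - i + 1 = w}"

definition lmco_delta :: "'a list \<Rightarrow> 'a set \<Rightarrow> nat \<Rightarrow> int" where
  "lmco_delta S Q i = int (lmco S Q i) - int (lmco S Q (i - 1))"

definition d_param :: "'a list \<Rightarrow> 'a set \<Rightarrow> nat" where
  "d_param S Q = card {i \<in> {2..length S}. lmco_delta S Q i \<noteq> 0}"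

section \<open>Word RAM\<close>

text \<open>
  A machine of word size \<open>w\<close> works on the words \<open>{0..<2 ^ w}\<close>. A program uses a constant number
  of registers, addressed directly, and an array of memory words, addressed indirectly through
  registers. All instructions have unit cost.
\<close>

datatype binop = Add | Sub | Mul | Div | Mod | And | Or | Xor | Shl | Shr

datatype instr =
    Const nat nat            \<comment> \<open>\<open>Const r v\<close>: register \<open>r\<close> gets the constant \<open>v\<close>\<close>
  | Op binop nat nat nat     \<comment> \<open>\<open>Op f r a b\<close>: register \<open>r\<close> gets \<open>f\<close> of registers \<open>a\<close> and \<open>b\<close>\<close>
  | Load nat nat             \<comment> \<open>\<open>Load r a\<close>: register \<open>r\<close> gets the memory word at the address in register \<open>a\<close>\<close>
  | Store nat nat            \<comment> \<open>\<open>Store a r\<close>: the memory word at the address in register \<open>a\<close> gets register \<open>r\<close>\<close>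
  | Jump nat
  | JumpLess nat nat nat     \<comment> \<open>\<open>JumpLess a b l\<close>: go to \<open>l\<close> if register \<open>a\<close> is less than register \<open>b\<close>\<close>
  | Halt

type_synonym program = "instr list"

fun eval_binop :: "nat \<Rightarrow> binop \<Rightarrow> nat \<Rightarrow> nat \<Rightarrow> nat" where
  "eval_binop w Add a b = (a + b) mod 2 ^ w"
| "eval_binop w Sub a b = (a + 2 ^ w - b) mod 2 ^ w"
| "eval_binop w Mul a b = (a * b) mod 2 ^ w"
| "eval_binop w Div a b = a div b"
| "eval_binop w Mod a b = a mod b"
| "eval_binop w And a b = and a b"
| "eval_binop w Or a b = or a b"
| "eval_binop w Xor a b = xor a b"
| "eval_binop w Shl a b = push_bit b a mod 2 ^ w"
| "eval_binop w Shr a b = drop_bit b a"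

record config =
  pc :: nat
  regs :: "nat \<Rightarrow> nat"
  mem :: "nat \<Rightarrow> nat"

text \<open>
  \<open>exec w k\<close> executes one instruction on a machine of word size \<open>w\<close> with the \<open>k\<close> memory words
  \<open>0, \<dots>, k - 1\<close>. An access to any other address is an error (\<open>None\<close>).
\<close>

fun exec :: "nat \<Rightarrow> nat \<Rightarrow> instr \<Rightarrow> config \<Rightarrow> config option" where
  "exec w k (Const r v) c =
     Some (c\<lparr>pc := pc c + 1, regs := (regs c)(r := v mod 2 ^ w)\<rparr>)"
| "exec w k (Op f r a b) c =
     Some (c\<lparr>pc := pc c + 1, regs := (regs c)(r := eval_binop w f (regs c a) (regs c b))\<rparr>)"
| "exec w k (Load r a) c =
     (if regs c a < k
      then Some (c\<lparr>pc := pc c + 1, regs := (regs c)(r := mem c (regs c a))\<rparr>) else None)"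
| "exec w k (Store a r) c =
     (if regs c a < k
      then Some (c\<lparr>pc := pc c + 1, mem := (mem c)(regs c a := regs c r)\<rparr>) else None)"
| "exec w k (Jump l) c = Some (c\<lparr>pc := l\<rparr>)"
| "exec w k (JumpLess a b l) c =
     Some (c\<lparr>pc := (if regs c a < regs c b then l else pc c + 1)\<rparr>)"
| "exec w k Halt c = None"

text \<open>
  \<open>halts_in w k P c t c'\<close>: started in \<open>c\<close>, the program \<open>P\<close> reaches a \<open>Halt\<close> instruction in
  configuration \<open>c'\<close>, having executed \<open>t\<close> instructions in total (the \<open>Halt\<close> included).
\<close>

inductive halts_in :: "nat \<Rightarrow> nat \<Rightarrow> program \<Rightarrow> config \<Rightarrow> nat \<Rightarrow> config \<Rightarrow> bool"
  for w :: nat and k :: nat and P :: program where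
  halt: "pc c < length P \<Longrightarrow> P ! pc c = Halt \<Longrightarrow> halts_in w k P c 1 c"
| step: "pc c < length P \<Longrightarrow> exec w k (P ! pc c) c = Some c' \<Longrightarrow> halts_in w k P c' t c''
     \<Longrightarrow> halts_in w k P c (Suc t) c''"

fun instr_regs :: "instr \<Rightarrow> nat set" where
  "instr_regs (Const r v) = {r}"
| "instr_regs (Op f r a b) = {r, a, b}"
| "instr_regs (Load r a) = {r, a}"
| "instr_regs (Store a r) = {a, r}"
| "instr_regs (Jump l) = {}"
| "instr_regs (JumpLess a b l) = {a, b}"
| "instr_regs Halt = {}"

text \<open>Register 0 is always counted, because it carries the input and the output.\<close>

definition num_regs :: "program \<Rightarrow> nat" where
  "num_regs P = Suc (Max (insert 0 (\<Union>(instr_regs ` set P))))"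

text \<open>
  Logarithmic word size: on inputs of size \<open>n\<close> the machine has \<open>\<Theta>(log n)\<close> bits per word, and
  the number \<open>n\<close> itself fits into a word.
\<close>

definition logarithmic_word_size :: "(nat \<Rightarrow> nat) \<Rightarrow> bool" where
  "logarithmic_word_size W \<longleftrightarrow>
     (\<forall>n. n < 2 ^ W n) \<and> (\<lambda>n. real (W n)) \<in> \<Theta>(\<lambda>n. ln (real n))"

section \<open>Data structures\<close>

text \<open>
  \<open>supports w P D ans t s\<close>: on a machine of word size \<open>w\<close>, the query algorithm \<open>P\<close>, run on a
  suitably prepared store, answers each query \<open>x \<in> D\<close> by \<open>ans x\<close>, in worst-case time \<open>t\<close> and with
  \<open>s\<close> words of space, registers and work space of the queries included.
  The query is passed in register 0, and the answer is returned there.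
  \<open>V\<close> consists of the contents of registers and memory that represent the preprocessed instance.
  A query may modify the store, but has to leave it in \<open>V\<close>, so that any sequence of queries
  is answered correctly. Only the \<open>num_regs P\<close> registers that occur in \<open>P\<close> and the first \<open>k\<close> memory
  words are ever accessed.
\<close>

definition supports ::
  "nat \<Rightarrow> program \<Rightarrow> nat set \<Rightarrow> (nat \<Rightarrow> nat) \<Rightarrow> real \<Rightarrow> real \<Rightarrow> bool" where
  "supports w P D ans t s \<longleftrightarrow>
     (\<exists>k V. real (num_regs P + k) \<le> s \<and> V \<noteq> {} \<and>
        (\<forall>(R, M) \<in> V. (\<forall>i. R i < 2 ^ w) \<and> (\<forall>a. M a < 2 ^ w)) \<and>
        (\<forall>(R, M) \<in> V. \<forall>x \<in> D. \<exists>\<tau> c'. real \<tau> \<le> t \<and>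
           halts_in w k P \<lparr>pc = 0, regs = R(0 := x), mem = M\<rparr> \<tau> c' \<and>
           regs c' 0 = ans x \<and> (regs c', mem c') \<in> V))"

text \<open>
  In the next definition \<open>F\<close> is \<open>co\<close> or \<open>lmco\<close>. The string \<open>S\<close> and the set \<open>Q\<close> are preprocessed,
  and a query is a length. One query algorithm \<open>P\<close> serves all instances.
\<close>

definition supports_count_queries ::
  "(nat list \<Rightarrow> nat set \<Rightarrow> nat \<Rightarrow> nat) \<Rightarrow> (nat \<Rightarrow> nat) \<Rightarrow> program \<Rightarrow>
     (nat \<Rightarrow> nat \<Rightarrow> nat \<Rightarrow> real) \<Rightarrow> (nat \<Rightarrow> nat \<Rightarrow> nat \<Rightarrow> real) \<Rightarrow> bool" where
  "supports_count_queries F W P f_t f_s \<longleftrightarrow>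
     (\<forall>S Q. finite Q \<and> card Q \<ge> 2 \<longrightarrow>
        supports (W (length S)) P {1..length S} (F S Q)
          (f_t (length S) (card Q) (d_param S Q))
          (f_s (length S) (card Q) (d_param S Q)))"

definition predecessor :: "nat set \<Rightarrow> nat \<Rightarrow> nat option" where
  "predecessor X x =
     (if {y \<in> X. y \<le> x} = {} then None else Some (Max {y \<in> X. y \<le> x}))"

text \<open>
  The word 0 reports that there is no predecessor. This is unambiguous, as all elements of the
  sets \<open>X\<close> considered here are at least 2.
\<close>

definition predecessor_word :: "nat set \<Rightarrow> nat \<Rightarrow> nat" where
  "predecessor_word X x = (case predecessor X x of None \<Rightarrow> 0 | Some y \<Rightarrow> y)"

text \<open>Every word is allowed as a query, also one outside the universe \<open>{2..u}\<close>.\<close>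

definition supports_predecessor_queries ::
  "nat \<Rightarrow> program \<Rightarrow> nat set \<Rightarrow> real \<Rightarrow> real \<Rightarrow> bool" where
  "supports_predecessor_queries w P X t s \<longleftrightarrow>
     supports w P {0..<2 ^ w} (predecessor_word X) t s"

end

theory Submission
  imports Defs "HOL-Real_Asymp.Real_Asymp"
begin

text \<open>
  For \<open>Q = {0, 1}\<close>, cut the string into blocks of length \<open>u\<close>, numbered from 0. For \<open>1 \<le> q \<le> Max X\<close>
  let \<open>s q\<close> be the least element of \<open>X\<close> that is at least \<open>q\<close>; block \<open>q\<close> starts with one letter of
  \<open>Q\<close> and carries the other one at distance \<open>s q - 1\<close>, the order of the two alternating from block to
  block; all other positions hold the letter 2. Because of the alternation, the left-minimal
  co-occurrences starting in block \<open>q\<close> have the lengths \<open>s q, s q + 1, \<dots>\<close> up to some bound beyond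
  \<open>u\<close>. Hence for \<open>x \<le> u\<close> the value \<open>lmco x\<close> is the number of \<open>q\<close> with \<open>s q \<le> x\<close>, which is the
  predecessor of \<open>x\<close>, and \<open>lmco\<close> changes only at the elements of \<open>X\<close>, at their translates by \<open>u\<close>,
  and at one further length. As block 0 is empty, \<open>co x - co (x - 1) = lmco x\<close> for \<open>2 \<le> x \<le> u\<close>, so
  one \<open>lmco\<close> query or two \<open>co\<close> queries at \<open>min x u\<close> suffice. The query program is inlined with its
  jumps relocated, and the caller keeps its data in fresh registers.
\<close>

section \<open>The string\<close>

lemma set_substring_map_upt:
  assumes "1 \<le> i" "j \<le> n"
  shows "set (substring (map f [1..<Suc n]) i j) = f ` {i..j}"
proof -
  have "take (j + 1 - i) [i..<Suc n] = [i..<Suc j]"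
    using assms by (cases "i \<le> Suc j") (auto simp: take_upt simp del: upt_Suc)
  then have "substring (map f [1..<Suc n]) i j = map f [i..<Suc j]"
    using assms by (simp add: substring_def drop_map take_map del: upt_Suc)
  then show ?thesis
    by (simp add: atLeastLessThanSuc_atLeastAtMost del: upt_Suc)
qed

lemma co_eq_lmco_plus_co:
  assumes w: "2 \<le> w" and no_prefix: "\<not> co_occurrence S Q 1 (w - 1)"
  shows "co S Q w = lmco S Q w + co S Q (w - 1)"
proof -
  let ?L = "{(i, j). left_minimal_co_occurrence S Q i j \<and> j - i + 1 = w}"
  let ?B = "{(i, j). co_occurrence S Q i j \<and> j - i + 1 = w - 1}"
  let ?f = "\<lambda>(i::nat, j::nat). (i - 1, j)"
  have fin: "finite {(i, j). co_occurrence S Q i j \<and> R i j}" for R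
    by (rule finite_subset[of _ "{0..length S} \<times> {0..length S}"])
      (auto simp: co_occurrence_def)
  have start: "2 \<le> i" if "co_occurrence S Q i j" "j - i + 1 = w - 1" for i j
  proof -
    have "1 \<le> i" using that by (simp add: co_occurrence_def)
    moreover have "i \<noteq> 1"
    proof
      assume "i = 1"
      moreover from this that have "j = w - 1" by (auto simp: co_occurrence_def)
      ultimately show False using that no_prefix by simp
    qed
    ultimately show ?thesis by simp
  qed
  have extend: "co_occurrence S Q (i - 1) j" if "co_occurrence S Q i j" "2 \<le> i" for i j
  proof -
    have "drop (i - 2) S = S ! (i - 2) # drop (i - 1) S"
      using that Cons_nth_drop_Suc[of "i - 2" S] by (auto simp: co_occurrence_def Suc_diff_Suc numeral_2_eq_2)
    then have "substring S (i - 1) j = S ! (i - 2) # substring S i j"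
      using that by (auto simp: substring_def co_occurrence_def Suc_diff_le numeral_2_eq_2)
    then show ?thesis using that by (auto simp: co_occurrence_def)
  qed
  have inj: "inj_on ?f ?B"
    using start by (force simp: inj_on_def)
  have split: "{(i, j). co_occurrence S Q i j \<and> j - i + 1 = w} = ?L \<union> ?f ` ?B"
  proof (intro equalityI subsetI)
    fix z assume "z \<in> {(i, j). co_occurrence S Q i j \<and> j - i + 1 = w}"
    then obtain i j where z: "z = (i, j)" "co_occurrence S Q i j" "j - i + 1 = w" by auto
    show "z \<in> ?L \<union> ?f ` ?B"
    proof (cases "co_occurrence S Q (i + 1) j")
      case True
      then have "(i + 1, j) \<in> ?B" using z w by (auto simp: co_occurrence_def)
      then have "?f (i + 1, j) \<in> ?f ` ?B" by (rule imageI)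
      then show ?thesis using z by simp
    next
      case False
      then show ?thesis using z by (auto simp: left_minimal_co_occurrence_def)
    qed
  next
    fix z assume "z \<in> ?L \<union> ?f ` ?B"
    then show "z \<in> {(i, j). co_occurrence S Q i j \<and> j - i + 1 = w}"
    proof
      assume "z \<in> ?f ` ?B"
      then obtain i j where z: "z = (i - 1, j)" "co_occurrence S Q i j" "j - i + 1 = w - 1" by auto
      have "2 \<le> i" "i \<le> j" using start z by (auto simp: co_occurrence_def)
      then show ?thesis using z extend w by auto
    qed (auto simp: left_minimal_co_occurrence_def)
  qed
  have disj: "?L \<inter> ?f ` ?B = {}"
  proof -
    have "\<not> left_minimal_co_occurrence S Q (i - 1) j" if "co_occurrence S Q i j" "2 \<le> i" for i j
      using that by (simp add: left_minimal_co_occurrence_def)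
    then show ?thesis using start by fastforce
  qed
  have finL: "finite ?L"
    by (rule finite_subset[OF _ fin[of "\<lambda>_ _. True"]]) (auto simp: left_minimal_co_occurrence_def)
  have "co S Q w = card ?L + card (?f ` ?B)"
    unfolding co_def split using disj fin finL by (intro card_Un_disjoint) auto
  also have "card (?f ` ?B) = co S Q (w - 1)"
    unfolding co_def by (rule card_image[OF inj])
  finally show ?thesis by (simp add: lmco_def)
qed

locale blocks =
  fixes u M :: nat and s :: "nat \<Rightarrow> nat"
  assumes u: "2 \<le> u" and M: "M \<le> u"
    and s: "q \<in> {1..M} \<Longrightarrow> s q \<in> {2..u}"
begin

definition letter :: "nat \<Rightarrow> nat" where
  "letter p = (let q = p div u in
     if q \<in> {1..M} \<and> p mod u = 0 then q mod 2
     else if q \<in> {1..M} \<and> p mod u = s q - 1 then Suc q mod 2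
     else 2)"

definition str :: "nat list" where
  "str = map letter [1..<Suc (2 * u\<^sup>2)]"

text \<open>
  One more than the last length of a left-minimal co-occurrence starting at the head of block \<open>q\<close>.
\<close>

definition stop :: "nat \<Rightarrow> nat" where
  "stop q = (if q < M then u + s (Suc q) else 2 * u\<^sup>2 + 2 - M * u)"

lemma length_str: "length str = 2 * u\<^sup>2"
  by (simp add: str_def del: upt_Suc)

lemma block_end:
  assumes "q \<in> {1..M}"
  shows "q * u + s q - 1 < Suc q * u" "q * u < q * u + s q - 1"
  using s[OF assms] by auto

lemma block_le_length:
  assumes "q \<le> M"
  shows "q * u \<le> u\<^sup>2" "q * u + u \<le> 2 * u\<^sup>2"
proof -
  have "q * u \<le> u * u" "1 * u \<le> u * u"
    using assms M u by (intro mult_le_mono; simp)+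
  then show "q * u \<le> u\<^sup>2" "q * u + u \<le> 2 * u\<^sup>2"
    unfolding power2_eq_square by linarith+
qed

lemma letter_head: "q \<in> {1..M} \<Longrightarrow> letter (q * u) = q mod 2"
  using u by (simp add: letter_def)

lemma letter_end:
  assumes "q \<in> {1..M}"
  shows "letter (q * u + s q - 1) = Suc q mod 2"
proof -
  have lt: "s q - 1 < u" and pos: "s q - 1 \<noteq> 0" using s[OF assms] by auto
  have eq: "q * u + s q - 1 = q * u + (s q - 1)" using s[OF assms] by auto
  have "(q * u + (s q - 1)) div u = q" "(q * u + (s q - 1)) mod u = s q - 1"
    using lt by auto
  then show ?thesis unfolding eq letter_def Let_def using assms pos by simp
qed

lemma letter_cases:
  assumes "letter p < 2"
  obtains q where "q \<in> {1..M}" "p = q * u" "letter p = q mod 2"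
  | q where "q \<in> {1..M}" "p = q * u + s q - 1" "letter p = Suc q mod 2"
proof -
  define q where "q = p div u"
  have p: "p = q * u + p mod u" by (simp add: q_def)
  have "q \<in> {1..M} \<and> (p mod u = 0 \<and> letter p = q mod 2 \<or> p mod u = s q - 1 \<and> letter p = Suc q mod 2)"
    using assms by (auto simp: letter_def Let_def q_def split: if_splits)
  then show ?thesis
    using that p s[of q] by (metis Nat.add_diff_assoc add.right_neutral atLeastAtMost_iff one_le_numeral order_trans)
qed

text \<open>
  The letters 0 and 1 form the word \<open>10|01|10|01|\<dots>\<close> (one group per block), so two neighbouring
  distinct ones always belong to the same block.
\<close>

lemma block_between:
  assumes "letter a < 2" "letter b < 2" "letter a \<noteq> letter b" "a < b"
  shows "\<exists>q\<in>{1..M}. a \<le> q * u \<and> q * u + s q - 1 \<le> b"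
proof -
  have mono: "Suc q * u \<le> q' * u" if "q < q'" for q q'
    using that by (intro mult_le_mono) auto
  have div_head: "(q * u) div u = q" for q using u by simp
  have div_end: "(q * u + s q - 1) div u = q" if "q \<in> {1..M}" for q
    using block_end[OF that] u by (intro div_nat_eqI) (auto simp: mult.commute)
  have ab: "a div u \<le> b div u" using assms by (simp add: div_le_mono)
  show ?thesis
    using assms(1)
  proof (cases rule: letter_cases)
    case (1 q)
    have "q * u + s q - 1 \<le> b"
      using assms(2)
    proof (cases rule: letter_cases)
      case (1 q')
      then have "q \<noteq> q'" using \<open>a = q * u\<close> assms by auto
      moreover have "q \<le> q'" using ab 1 \<open>a = q * u\<close> div_head by simp
      ultimately have "Suc q * u \<le> b" using mono[of q q'] 1 by simp
      then show ?thesis using block_end[OF \<open>q \<in> {1..M}\<close>] by simp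
    next
      case (2 q')
      have "q \<le> q'" using ab 2 \<open>a = q * u\<close> div_head div_end by simp
      then consider "q = q'" | "q < q'" by linarith
      then show ?thesis
      proof cases
        case 2
        then have "Suc q * u \<le> b" using mono[of q q'] \<open>b = _\<close> block_end[OF \<open>q' \<in> {1..M}\<close>] by linarith
        then show ?thesis using block_end[OF \<open>q \<in> {1..M}\<close>] by simp
      qed (use \<open>b = _\<close> in simp)
    qed
    then show ?thesis using 1 by auto
  next
    case (2 q)
    have bq: "q \<le> b div u" using ab 2 div_end by simp
    have "\<exists>q'\<in>{1..M}. Suc q \<le> q' \<and> q' * u + s q' - 1 \<le> b"
      using assms(2)
    proof (cases rule: letter_cases)
      case (1 q')
      have "q' \<noteq> q" using 1 \<open>a = _\<close> assms(4) block_end[OF \<open>q \<in> {1..M}\<close>] by auto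
      moreover have "q' \<noteq> Suc q" using 1 \<open>letter a = _\<close> assms(3) by auto
      moreover have "q \<le> q'" using bq 1 div_head by simp
      ultimately have lt: "Suc q < q'" by linarith
      then have in_M: "Suc q \<in> {1..M}" using 1 by auto
      show ?thesis
        using block_end[OF in_M] mono[OF lt] 1 in_M by (intro bexI[of _ "Suc q"]) auto
    next
      case (2 q')
      have "q' \<noteq> q" using 2 \<open>a = _\<close> assms(4) by auto
      moreover have "q \<le> q'" using bq 2 div_end by simp
      ultimately show ?thesis using 2 by (intro bexI[of _ q']) auto
    qed
    then obtain q' where q': "q' \<in> {1..M}" "Suc q \<le> q'" "q' * u + s q' - 1 \<le> b" by blast
    then have "a \<le> q' * u" using mono[of q q'] block_end[OF \<open>q \<in> {1..M}\<close>] 2 by simp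
    then show ?thesis using q' by blast
  qed
qed

lemma co_occurrence_str_iff:
  "co_occurrence str {0, 1} i j \<longleftrightarrow>
     1 \<le> i \<and> j \<le> 2 * u\<^sup>2 \<and> (\<exists>q\<in>{1..M}. i \<le> q * u \<and> q * u + s q - 1 \<le> j)"
  (is "?L \<longleftrightarrow> ?R")
proof
  assume ?L
  then have ij: "1 \<le> i" "j \<le> 2 * u\<^sup>2" and "{0, 1} \<subseteq> letter ` {i..j}"
    using set_substring_map_upt[of i j "2 * u\<^sup>2" letter]
    by (auto simp: co_occurrence_def length_str str_def simp del: upt_Suc)
  then have "0 \<in> letter ` {i..j}" "1 \<in> letter ` {i..j}" by blast+
  then obtain a b where ab: "a \<in> {i..j}" "b \<in> {i..j}" "letter a = 0" "letter b = 1"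
    by (elim imageE) simp
  then consider "a < b" | "b < a" by (cases a b rule: linorder_cases) auto
  then show ?R
  proof cases
    case 1
    then obtain q where "q \<in> {1..M}" "a \<le> q * u" "q * u + s q - 1 \<le> b"
      using block_between[of a b] ab by auto
    then show ?thesis using ab ij by (intro conjI bexI[of _ q]) auto
  next
    case 2
    then obtain q where "q \<in> {1..M}" "b \<le> q * u" "q * u + s q - 1 \<le> a"
      using block_between[of b a] ab by auto
    then show ?thesis using ab ij by (intro conjI bexI[of _ q]) auto
  qed
next
  assume ?R
  then obtain q where q: "q \<in> {1..M}" "i \<le> q * u" "q * u + s q - 1 \<le> j"
    and ij: "1 \<le> i" "j \<le> 2 * u\<^sup>2" by blast
  have "q * u \<in> {i..j}" "q * u + s q - 1 \<in> {i..j}"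
    using q block_end[OF q(1)] by auto
  then have "{q mod 2, Suc q mod 2} \<subseteq> letter ` {i..j}"
    using letter_head[OF q(1)] letter_end[OF q(1)] by (metis empty_subsetI imageI insert_subset)
  moreover have "{q mod 2, Suc q mod 2} = {0, 1}" by (auto simp: mod_Suc)
  ultimately show ?L
    using set_substring_map_upt[OF ij, of letter] ij q block_end[OF q(1)]
    by (auto simp: co_occurrence_def length_str str_def simp del: upt_Suc)
qed

lemma left_minimal_str_iff:
  "left_minimal_co_occurrence str {0, 1} i j \<longleftrightarrow>
     (\<exists>q\<in>{1..M}. i = q * u \<and> q * u + s q - 1 \<le> j \<and> j + 1 < q * u + stop q)"
  (is "?L \<longleftrightarrow> ?R")
proof
  assume ?L
  then obtain q where q: "q \<in> {1..M}" "i \<le> q * u" "q * u + s q - 1 \<le> j"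
    and ij: "1 \<le> i" "j \<le> 2 * u\<^sup>2" and min: "\<And>q'. q' \<in> {1..M} \<Longrightarrow> i + 1 \<le> q' * u \<Longrightarrow> j < q' * u + s q' - 1"
    unfolding left_minimal_co_occurrence_def co_occurrence_str_iff by (meson le_add2 not_le)
  have i: "i = q * u" using q min[OF q(1)] by linarith
  have "j + 1 < q * u + stop q"
  proof (cases "q < M")
    case True
    then have "j < Suc q * u + s (Suc q) - 1" using min[of "Suc q"] i u by auto
    then show ?thesis using True by (simp add: stop_def)
  next
    case False
    then have "q = M" using q by simp
    then show ?thesis using ij block_le_length[of M] by (simp add: stop_def)
  qed
  then show ?R using q i by blast
next
  assume ?R
  then obtain q where q: "q \<in> {1..M}" "i = q * u" "q * u + s q - 1 \<le> j" "j + 1 < q * u + stop q"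
    by blast
  have i: "1 \<le> i" using q u by simp
  have j: "j \<le> 2 * u\<^sup>2"
  proof (cases "q < M")
    case True
    then have "s (Suc q) \<le> u" using s[of "Suc q"] by simp
    then show ?thesis using q block_le_length[of "Suc q"] True by (simp add: stop_def)
  next
    case False
    then have "q = M" using q by simp
    then show ?thesis using q block_le_length[of M] by (simp add: stop_def)
  qed
  have "j < q' * u + s q' - 1" if q': "q' \<in> {1..M}" "i + 1 \<le> q' * u" for q'
  proof -
    have "q < q'" using q' q by (metis Suc_eq_plus1 Suc_le_lessD mult_less_cancel2)
    then have "q < M" using q' by simp
    then have j: "j < Suc q * u + s (Suc q) - 1" using q s[of "Suc q"] by (simp add: stop_def)
    show ?thesis
    proof (cases "q' = Suc q")
      case False
      then have "Suc (Suc q) * u \<le> q' * u" using \<open>q < q'\<close> by (intro mult_le_mono) auto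
      then show ?thesis using j block_end[of "Suc q"] block_end[OF q'(1)] \<open>q < M\<close> by simp
    qed (use j in simp)
  qed
  then show ?L
    using q i j unfolding left_minimal_co_occurrence_def co_occurrence_str_iff
    by (metis not_le order_refl)
qed

lemma lmco_str: "lmco str {0, 1} w = card {q \<in> {1..M}. s q \<le> w \<and> w < stop q}"
proof -
  let ?f = "\<lambda>q. (q * u, q * u + w - 1)"
  have "{(i, j). left_minimal_co_occurrence str {0, 1} i j \<and> j - i + 1 = w} =
      ?f ` {q \<in> {1..M}. s q \<le> w \<and> w < stop q}"
  proof (intro equalityI subsetI)
    fix z assume "z \<in> {(i, j). left_minimal_co_occurrence str {0, 1} i j \<and> j - i + 1 = w}"
    then obtain q j where q: "q \<in> {1..M}" "q * u + s q - 1 \<le> j" "j + 1 < q * u + stop q"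
      and z: "z = (q * u, j)" "j - q * u + 1 = w"
      unfolding left_minimal_str_iff by blast
    have "j + 1 = q * u + w" using z q block_end[OF q(1)] by linarith
    then show "z \<in> ?f ` {q \<in> {1..M}. s q \<le> w \<and> w < stop q}"
      using z q by (intro image_eqI[of _ _ q]) auto
  next
    fix z assume "z \<in> ?f ` {q \<in> {1..M}. s q \<le> w \<and> w < stop q}"
    then obtain q where "q \<in> {1..M}" "s q \<le> w" "w < stop q" "z = ?f q" by blast
    then show "z \<in> {(i, j). left_minimal_co_occurrence str {0, 1} i j \<and> j - i + 1 = w}"
      using s[of q] unfolding left_minimal_str_iff by (auto intro!: bexI[of _ q])
  qed
  moreover have "inj ?f" using u by (auto simp: inj_on_def)
  ultimately show ?thesis
    unfolding lmco_def by (metis (no_types, lifting) card_image inj_on_subset subset_UNIV)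
qed

lemma lmco_str_small:
  assumes "w \<le> u"
  shows "lmco str {0, 1} w = card {q \<in> {1..M}. s q \<le> w}"
proof -
  have "w < stop q" if "q \<in> {1..M}" for q
    using that assms s[of "Suc q"] block_le_length[of M] by (auto simp: stop_def)
  then show ?thesis unfolding lmco_str by (metis (mono_tags, lifting))
qed

lemma co_str_step:
  assumes "2 \<le> w" "w \<le> u"
  shows "co str {0, 1} w = lmco str {0, 1} w + co str {0, 1} (w - 1)"
proof (rule co_eq_lmco_plus_co[OF assms(1)])
  have "w - 1 < q * u + s q - 1" if "q \<in> {1..M}" for q
  proof -
    have "1 * u \<le> q * u" using that by (intro mult_le_mono) auto
    moreover have "2 \<le> s q" using s[OF that] by simp
    ultimately show ?thesis using assms by linarith
  qed
  then show "\<not> co_occurrence str {0, 1} 1 (w - 1)"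
    unfolding co_occurrence_str_iff by (meson not_le)
qed

lemma d_param_str:
  "d_param str {0, 1} \<le> card (s ` {1..M}) + card (stop ` {1..M})"
proof -
  have "{i \<in> {2..length str}. lmco_delta str {0, 1} i \<noteq> 0} \<subseteq> s ` {1..M} \<union> stop ` {1..M}"
  proof (rule subsetI, rule ccontr)
    fix i
    assume i: "i \<in> {i \<in> {2..length str}. lmco_delta str {0, 1} i \<noteq> 0}"
      and out: "i \<notin> s ` {1..M} \<union> stop ` {1..M}"
    have "s q \<le> i \<and> i < stop q \<longleftrightarrow> s q \<le> i - 1 \<and> i - 1 < stop q" if "q \<in> {1..M}" for q
    proof -
      have "s q \<noteq> i" "stop q \<noteq> i" using that out by auto
      then show ?thesis using i by auto
    qed
    then have "{q \<in> {1..M}. s q \<le> i \<and> i < stop q} = {q \<in> {1..M}. s q \<le> i - 1 \<and> i - 1 < stop q}"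
      by blast
    then have "lmco_delta str {0, 1} i = 0" unfolding lmco_delta_def lmco_str by simp
    then show False using i by simp
  qed
  then have "d_param str {0, 1} \<le> card (s ` {1..M} \<union> stop ` {1..M})"
    unfolding d_param_def by (intro card_mono) auto
  also have "\<dots> \<le> card (s ` {1..M}) + card (stop ` {1..M})" by (rule card_Un_le)
  finally show ?thesis .
qed

end

lemma predecessor_string:
  assumes u: "2 \<le> u" and X: "X \<subseteq> {2..u}"
  obtains S :: "nat list" and Q :: "nat set"
  where "length S = 2 * u\<^sup>2" "finite Q" "card Q = 2" "d_param S Q \<le> 8 * card X"
    "\<And>x. x \<le> u \<Longrightarrow> lmco S Q x = predecessor_word X x"
    "\<And>x. 2 \<le> x \<Longrightarrow> x \<le> u \<Longrightarrow> co S Q x = lmco S Q x + co S Q (x - 1)"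
proof -
  define M where "M = Max (insert 0 X)"
  define s where "s q = Min {y \<in> X. q \<le> y}" for q
  have fin: "finite X" using X finite_subset by blast
  have M_in: "M \<in> insert 0 X" unfolding M_def using fin by (intro Max_in) auto
  have M_ge: "y \<le> M" if "y \<in> X" for y unfolding M_def using fin that by simp
  have s_in: "s q \<in> X \<and> q \<le> s q" if "q \<in> {1..M}" for q
  proof -
    have "M \<in> {y \<in> X. q \<le> y}" using that M_in by auto
    then have "s q \<in> {y \<in> X. q \<le> y}" unfolding s_def using fin by (intro Min_in) auto
    then show ?thesis by simp
  qed
  have s_le: "s q \<le> y" if "y \<in> X" "q \<le> y" for q y
    unfolding s_def using fin that by simp
  interpret blocks u M s
  proof
    show "M \<le> u" using M_in X by auto
    show "s q \<in> {2..u}" if "q \<in> {1..M}" for q using s_in[OF that] X by auto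
  qed (rule u)
  have pred: "lmco str {0, 1} x = predecessor_word X x" if x: "x \<le> u" for x
  proof -
    have iff: "q \<in> {1..M} \<and> s q \<le> x \<longleftrightarrow> 1 \<le> q \<and> (\<exists>y\<in>{y \<in> X. y \<le> x}. q \<le> y)" for q
      using s_in[of q] s_le M_ge by (auto intro: order_trans)
    have "{q \<in> {1..M}. s q \<le> x} = {1..predecessor_word X x}"
    proof (cases "{y \<in> X. y \<le> x} = {}")
      case True
      then show ?thesis using iff by (auto simp: predecessor_word_def predecessor_def)
    next
      case False
      then have "(\<exists>y\<in>{y \<in> X. y \<le> x}. q \<le> y) \<longleftrightarrow> q \<le> Max {y \<in> X. y \<le> x}" for q
        using fin by (subst Max_ge_iff) auto
      then show ?thesis using iff False by (auto simp: predecessor_word_def predecessor_def)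
    qed
    then show ?thesis using lmco_str_small[OF x] by simp
  qed
  have d: "d_param str {0, 1} \<le> 8 * card X"
  proof (cases "M = 0")
    case True
    then show ?thesis using d_param_str by simp
  next
    case False
    then have "X \<noteq> {}" using M_in by auto
    then have pos: "1 \<le> card X" using fin by (simp add: Suc_leI card_gt_0_iff)
    have "card (s ` {1..M}) \<le> card X" using s_in fin by (intro card_mono) auto
    moreover have "card (stop ` {1..M}) \<le> Suc (card X)"
    proof -
      have "stop ` {1..M} \<subseteq> insert (2 * u\<^sup>2 + 2 - M * u) ((+) u ` X)"
        using s_in by (auto simp: stop_def)
      then have "card (stop ` {1..M}) \<le> card (insert (2 * u\<^sup>2 + 2 - M * u) ((+) u ` X))"
        using fin by (intro card_mono) auto
      also have "\<dots> \<le> Suc (card ((+) u ` X))" using fin by (simp add: card_insert_if)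
      also have "\<dots> \<le> Suc (card X)" using card_image_le[OF fin] by simp
      finally show ?thesis .
    qed
    ultimately show ?thesis using d_param_str pos by linarith
  qed
  show ?thesis
    by (rule that[OF length_str _ _ d pred co_str_step]) auto
qed

section \<open>Programs calling programs\<close>

fun relocate_instr :: "nat \<Rightarrow> nat \<Rightarrow> instr \<Rightarrow> instr" where
  "relocate_instr b e (Jump l) = Jump (b + l)"
| "relocate_instr b e (JumpLess x y l) = JumpLess x y (b + l)"
| "relocate_instr b e Halt = Jump e"
| "relocate_instr b e ins = ins"

definition relocate :: "nat \<Rightarrow> program \<Rightarrow> program" where
  "relocate b P = map (relocate_instr b (b + length P)) P"

definition code_at :: "program \<Rightarrow> nat \<Rightarrow> program \<Rightarrow> bool" where
  "code_at P' b P \<longleftrightarrow> (\<exists>A B. P' = A @ relocate b P @ B \<and> length A = b)"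

definition merge :: "nat \<Rightarrow> (nat \<Rightarrow> nat) \<Rightarrow> (nat \<Rightarrow> nat) \<Rightarrow> nat \<Rightarrow> nat" where
  "merge N R E i = (if i < N then R i else E i)"

lemma length_relocate [simp]: "length (relocate b P) = length P"
  by (simp add: relocate_def)

lemma instr_regs_relocate [simp]: "instr_regs (relocate_instr b e ins) = instr_regs ins"
  by (cases ins) auto

lemma regs_lt_num_regs: "ins \<in> set P \<Longrightarrow> instr_regs ins \<subseteq> {..<num_regs P}"
proof
  fix r assume "ins \<in> set P" "r \<in> instr_regs ins"
  moreover have "finite (instr_regs ins)" for ins by (cases ins) auto
  ultimately show "r \<in> {..<num_regs P}"
    unfolding num_regs_def lessThan_iff less_Suc_eq_le by (intro Max_ge) auto
qed

lemma num_regs_le: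
  assumes "\<And>ins. ins \<in> set P \<Longrightarrow> instr_regs ins \<subseteq> {..<N}" "0 < N"
  shows "num_regs P \<le> N"
proof -
  have fin: "finite (instr_regs ins)" for ins by (cases ins) auto
  have "Max (insert 0 (\<Union>(instr_regs ` set P))) < N"
    using assms fin by (subst Max_less_iff) auto
  then show ?thesis by (simp add: num_regs_def)
qed

lemma num_regs_pos: "0 < num_regs P"
  by (simp add: num_regs_def)

lemma exec_relocate:
  assumes "exec w k ins c = Some c'" "instr_regs ins \<subseteq> {..<N}"
  shows "exec w k (relocate_instr b e ins) \<lparr>pc = b + pc c, regs = merge N (regs c) E, mem = mem c\<rparr>
    = Some \<lparr>pc = b + pc c', regs = merge N (regs c') E, mem = mem c'\<rparr>"
  using assms by (cases ins) (auto simp: merge_def fun_eq_iff split: if_splits)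

lemma halts_in_call:
  assumes run: "halts_in w k P c t c'" and code: "code_at P' b P" and N: "N = num_regs P"
    and rest: "halts_in w k P' \<lparr>pc = b + length P, regs = merge N (regs c') E, mem = mem c'\<rparr> t' c''"
  shows "halts_in w k P' \<lparr>pc = b + pc c, regs = merge N (regs c) E, mem = mem c\<rparr> (t + t') c''"
  using run rest
proof (induction rule: halts_in.induct)
  case (halt c)
  have "b + pc c < length P'" "P' ! (b + pc c) = Jump (b + length P)"
    using code halt by (auto simp: code_at_def nth_append relocate_def)
  then show ?case using halts_in.step[of _ P' w k] halt by force
next
  case (step c c1 t c')
  have len: "b + pc c < length P'"
    and nth: "P' ! (b + pc c) = relocate_instr b (b + length P) (P ! pc c)"
    using code step.hyps(1) by (auto simp: code_at_def nth_append relocate_def)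
  have "instr_regs (P ! pc c) \<subseteq> {..<N}"
    using step.hyps(1) regs_lt_num_regs N by simp
  from exec_relocate[OF step.hyps(2) this, of b "b + length P" E] step.IH[OF step.prems] len nth
  show ?case by (auto intro!: halts_in.step)
qed

lemma halts_in_pos: "halts_in w k P c t c' \<Longrightarrow> 1 \<le> t"
  by (induction rule: halts_in.induct) auto

definition answers ::
  "nat \<Rightarrow> nat \<Rightarrow> program \<Rightarrow> ((nat \<Rightarrow> nat) \<times> (nat \<Rightarrow> nat)) set \<Rightarrow> nat set \<Rightarrow> (nat \<Rightarrow> nat) \<Rightarrow> real \<Rightarrow> bool"
where
  "answers w k P V D ans t \<longleftrightarrow>
     (\<forall>(R, M) \<in> V. (\<forall>i. R i < 2 ^ w) \<and> (\<forall>a. M a < 2 ^ w)) \<and>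
     (\<forall>(R, M) \<in> V. \<forall>x \<in> D. \<exists>\<tau> c'. real \<tau> \<le> t \<and>
        halts_in w k P \<lparr>pc = 0, regs = R(0 := x), mem = M\<rparr> \<tau> c' \<and>
        regs c' 0 = ans x \<and> (regs c', mem c') \<in> V)"

lemma supports_iff_answers:
  "supports w P D ans t s \<longleftrightarrow>
     (\<exists>k V. real (num_regs P + k) \<le> s \<and> V \<noteq> {} \<and> answers w k P V D ans t)"
  by (simp add: supports_def answers_def)

lemma answersE:
  assumes "answers w k P V D ans t" "(R, M) \<in> V" "x \<in> D"
  obtains \<tau> c' where "real \<tau> \<le> t" "halts_in w k P \<lparr>pc = 0, regs = R(0 := x), mem = M\<rparr> \<tau> c'"
    "regs c' 0 = ans x" "(regs c', mem c') \<in> V"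
  using assms unfolding answers_def by fast

lemma answers_words:
  assumes "answers w k P V D ans t" "(R, M) \<in> V"
  shows "R i < 2 ^ w" "M a < 2 ^ w"
  using assms unfolding answers_def by fast+

lemma supports_bounds:
  assumes "supports w P D ans t s" "D \<noteq> {}"
  shows "1 \<le> t" "1 \<le> s"
proof -
  obtain k V where s: "real (num_regs P + k) \<le> s" and "V \<noteq> {}" and V: "answers w k P V D ans t"
    using assms(1) unfolding supports_iff_answers by blast
  then obtain R M x where "(R, M) \<in> V" "x \<in> D" using assms(2) by auto
  with V obtain \<tau> c' where "real \<tau> \<le> t" "halts_in w k P \<lparr>pc = 0, regs = R(0 := x), mem = M\<rparr> \<tau> c'"
    by (rule answersE)
  then show "1 \<le> t" using halts_in_pos by fastforce
  show "1 \<le> s" using s num_regs_pos[of P] by linarith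
qed

lemma supports_weaken:
  assumes "supports w P D ans t s" "t \<le> t'" "s \<le> s'" "D' \<subseteq> D" "\<And>x. x \<in> D' \<Longrightarrow> ans x = ans' x"
  shows "supports w P D' ans' t' s'"
proof -
  obtain k V where kV: "real (num_regs P + k) \<le> s" "V \<noteq> {}" and V: "answers w k P V D ans t"
    using assms(1) unfolding supports_iff_answers by blast
  have "\<exists>\<tau> c'. real \<tau> \<le> t' \<and> halts_in w k P \<lparr>pc = 0, regs = R(0 := x), mem = M\<rparr> \<tau> c' \<and>
      regs c' 0 = ans' x \<and> (regs c', mem c') \<in> V" if RM: "(R, M) \<in> V" and x: "x \<in> D'" for R M x
  proof -
    have "x \<in> D" using x assms(4) by blast
    with V RM obtain \<tau> c' where "real \<tau> \<le> t"
        "halts_in w k P \<lparr>pc = 0, regs = R(0 := x), mem = M\<rparr> \<tau> c'"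
        "regs c' 0 = ans x" "(regs c', mem c') \<in> V"
      by (rule answersE)
    then show ?thesis using assms(2,5) x by (intro exI[of _ \<tau>] exI[of _ c']) auto
  qed
  then have "answers w k P V D' ans' t'" using V unfolding answers_def by blast
  then show ?thesis unfolding supports_iff_answers using kV assms(3) by (meson order_trans)
qed

text \<open>
  A caller of \<open>P\<close> keeps its own data in the registers from \<open>num_regs P\<close> on, constrained by \<open>C\<close>.
  Register 0 is unconstrained between queries, since the next query overwrites it.
\<close>

definition caller_states ::
  "nat \<Rightarrow> nat \<Rightarrow> ((nat \<Rightarrow> nat) \<times> (nat \<Rightarrow> nat)) set \<Rightarrow> ((nat \<Rightarrow> nat) \<Rightarrow> bool) \<Rightarrow>
     ((nat \<Rightarrow> nat) \<times> (nat \<Rightarrow> nat)) set" where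
  "caller_states w N V C = {(R', M). \<exists>R. (R, M) \<in> V \<and> (\<forall>i. 0 < i \<and> i < N \<longrightarrow> R' i = R i) \<and>
     (\<forall>i. R' i < 2 ^ w) \<and> C R'}"

lemma supports_caller:
  assumes P: "supports w P D ans t s" and N: "N = num_regs P"
    and regs: "num_regs P' \<le> N + r"
    and init: "C E" "\<And>i. E i < 2 ^ w" "\<forall>R R'. (\<forall>i\<ge>N. R i = R' i) \<longrightarrow> C R \<longrightarrow> C R'"
    and step: "\<And>k V R M x. answers w k P V D ans t \<Longrightarrow>
         (R, M) \<in> caller_states w N V C \<Longrightarrow> x \<in> D' \<Longrightarrow>
         \<exists>\<tau> c'. real \<tau> \<le> t' \<and> halts_in w k P' \<lparr>pc = 0, regs = R(0 := x), mem = M\<rparr> \<tau> c' \<and>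
           regs c' 0 = ans' x \<and> (regs c', mem c') \<in> caller_states w N V C"
  shows "supports w P' D' ans' t' (s + real r)"
proof -
  obtain k V where kV: "real (num_regs P + k) \<le> s" "V \<noteq> {}" and V: "answers w k P V D ans t"
    using P unfolding supports_iff_answers by blast
  let ?V = "caller_states w N V C"
  obtain R M where RM: "(R, M) \<in> V" using kV by auto
  have "C (merge N R E)" using init(1,3) by (metis leD merge_def)
  then have "(merge N R E, M) \<in> ?V"
    unfolding caller_states_def using RM answers_words[OF V RM] init(2)
    by (auto simp: merge_def intro!: exI[of _ R])
  then have ne: "?V \<noteq> {}" by blast
  have "(\<forall>i. R i < 2 ^ w) \<and> (\<forall>a. M a < 2 ^ w)" if "(R, M) \<in> ?V" for R M
    using that answers_words(2)[OF V] by (auto simp: caller_states_def)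
  then have "answers w k P' ?V D' ans' t'"
    unfolding answers_def using step[OF V] by blast
  moreover have "real (num_regs P' + k) \<le> s + real r" using kV(1) regs N by linarith
  ultimately show ?thesis unfolding supports_iff_answers using ne by blast
qed

lemma halts_in_caller:
  assumes V: "answers w k P V D ans t" and N: "N = num_regs P"
    and C: "\<forall>R R'. (\<forall>i\<ge>N. R i = R' i) \<longrightarrow> C R \<longrightarrow> C R'"
    and state: "(R, M) \<in> caller_states w N V C" and y: "R 0 \<in> D" and code: "code_at P' b P"
  obtains \<tau> R' M' where "real \<tau> \<le> t" "(R', M') \<in> caller_states w N V C"
    "R' 0 = ans (R 0)" "\<And>i. N \<le> i \<Longrightarrow> R' i = R i"
    "\<And>t' c''. halts_in w k P' \<lparr>pc = b + length P, regs = R', mem = M'\<rparr> t' c'' \<Longrightarrow>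
       halts_in w k P' \<lparr>pc = b, regs = R, mem = M\<rparr> (\<tau> + t') c''"
proof -
  obtain R0 where R0: "(R0, M) \<in> V" "\<forall>i. 0 < i \<and> i < N \<longrightarrow> R i = R0 i"
    and R: "\<forall>i. R i < 2 ^ w" "C R"
    using state by (auto simp: caller_states_def)
  obtain \<tau> c' where c': "real \<tau> \<le> t"
      "halts_in w k P \<lparr>pc = 0, regs = R0(0 := R 0), mem = M\<rparr> \<tau> c'"
      "regs c' 0 = ans (R 0)" "(regs c', mem c') \<in> V"
    using V R0(1) y by (rule answersE)
  have merge: "merge N (R0(0 := R 0)) R = R"
    using R0 by (auto simp: merge_def fun_eq_iff)
  have "N > 0" using N num_regs_pos by simp
  have "C (merge N (regs c') R)" using C R(2) by (metis leD merge_def)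
  then have "(merge N (regs c') R, mem c') \<in> caller_states w N V C"
    using c'(4) R answers_words(1)[OF V c'(4)]
    by (auto simp: caller_states_def merge_def intro!: exI[of _ "regs c'"])
  moreover have "halts_in w k P' \<lparr>pc = b, regs = R, mem = M\<rparr> (\<tau> + t') c''"
    if "halts_in w k P' \<lparr>pc = b + length P, regs = merge N (regs c') R, mem = mem c'\<rparr> t' c''" for t' c''
    using halts_in_call[OF c'(2) code N that] by (simp add: merge)
  ultimately show ?thesis
    using that[of \<tau> "merge N (regs c') R" "mem c'"] c' \<open>N > 0\<close>
    by (simp add: merge_def)
qed

lemma caller_states_update:
  assumes "(R, M) \<in> caller_states w N V C" "\<And>i. 0 < i \<Longrightarrow> i < N \<Longrightarrow> R' i = R i"
    "\<And>i. R' i < 2 ^ w" "C R'"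
  shows "(R', M) \<in> caller_states w N V C"
  using assms by (auto simp: caller_states_def)

definition clamp :: "program \<Rightarrow> program" where
  "clamp P = (let N = num_regs P; l = length P in
     [JumpLess N 0 3, JumpLess 0 (N + 1) (5 + l), Jump 4, Op Or 0 N N] @
     relocate 4 P @ [Halt, Const 0 0, Halt])"

lemma supports_clamp:
  assumes P: "supports w P {2..u} ans t s" and u: "2 \<le> u" "u < 2 ^ w"
  shows "supports w (clamp P) {0..<2 ^ w} (\<lambda>x. if x < 2 then 0 else ans (min x u)) (t + 4) (s + 2)"
proof -
  define N where "N = num_regs P"
  define l where "l = length P"
  define C where "C R \<longleftrightarrow> R N = u \<and> R (N + 1) = 2" for R :: "nat \<Rightarrow> nat"
  have N0: "0 < N" by (simp add: N_def num_regs_pos)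
  have code: "code_at (clamp P) 4 P"
    unfolding code_at_def clamp_def Let_def by (intro exI conjI, rule refl) simp
  have len: "length (clamp P) = l + 7" by (simp add: clamp_def Let_def l_def)
  have nth: "clamp P ! 0 = JumpLess N 0 3" "clamp P ! 1 = JumpLess 0 (N + 1) (5 + l)"
    "clamp P ! 2 = Jump 4" "clamp P ! 3 = Op Or 0 N N" "clamp P ! (4 + l) = Halt"
    "clamp P ! (5 + l) = Const 0 0" "clamp P ! (6 + l) = Halt"
    by (simp_all add: clamp_def Let_def N_def l_def nth_append nth_Cons')
  have regs: "num_regs (clamp P) \<le> N + 2"
    by (rule num_regs_le) (use regs_lt_num_regs[of _ P] N0 in
      \<open>fastforce simp: clamp_def Let_def N_def relocate_def subset_iff\<close>)+
  have Ccong: "\<forall>R R'. (\<forall>i\<ge>N. R i = R' i) \<longrightarrow> C R \<longrightarrow> C R'"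
    unfolding C_def by force
  have "supports w (clamp P) {0..<2 ^ w} (\<lambda>x. if x < 2 then 0 else ans (min x u)) (t + 4) (s + real 2)"
  proof (rule supports_caller[where C = C and E = "\<lambda>i. if i = N then u else 2",
        OF P N_def regs _ _ Ccong])
    show "C (\<lambda>i. if i = N then u else 2)" by (simp add: C_def)
    show "(if i = N then u else 2) < 2 ^ w" for i using u by simp
  next
    fix k :: nat and V R M and x :: nat
    let ?V = "caller_states w N V C"
    assume V: "answers w k P V {2..u} ans t"
      and st: "(R, M) \<in> ?V" and x: "x \<in> {0..<2 ^ w}"
    have RN: "R N = u" "R (N + 1) = 2" and Rw: "\<And>i. R i < 2 ^ w"
      using st by (auto simp: caller_states_def C_def)
    have upd: "(R(0 := y), M) \<in> ?V" if "y < 2 ^ w" for y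
      using that Rw RN N0 by (intro caller_states_update[OF st]) (auto simp: C_def)
    have t0: "0 \<le> t" using supports_bounds[OF P] u by force
    let ?H = "halts_in w k (clamp P)"
    let ?c = "\<lambda>p y. \<lparr>pc = p, regs = R(0 := y), mem = M\<rparr>"
    show "\<exists>\<tau> c'. real \<tau> \<le> t + 4 \<and> halts_in w k (clamp P) (?c 0 x) \<tau> c' \<and>
           regs c' 0 = (if x < 2 then 0 else ans (min x u)) \<and> (regs c', mem c') \<in> ?V"
    proof (cases "x < 2")
      case True
      have h: "?H (?c (6 + l) 0) 1 (?c (6 + l) 0)"
        by (rule halts_in.halt) (simp_all add: len nth)
      have h: "?H (?c (5 + l) x) (Suc 1) (?c (6 + l) 0)"
        by (rule halts_in.step[OF _ _ h]) (simp_all add: len nth)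
      have h: "?H (?c 1 x) (Suc (Suc 1)) (?c (6 + l) 0)"
        by (rule halts_in.step[OF _ _ h]) (use True RN N0 nth(2) in \<open>auto simp: len\<close>)
      have "?H (?c 0 x) (Suc (Suc (Suc 1))) (?c (6 + l) 0)"
        by (rule halts_in.step[OF _ _ h]) (use True RN N0 nth(1) u in \<open>auto simp: len\<close>)
      then show ?thesis using True upd[of 0] t0 by (intro exI[of _ "Suc (Suc (Suc 1))"] exI[of _ "?c (6 + l) 0"]) auto
    next
      case False
      define y where "y = min x u"
      have y: "y \<in> {2..u}" "y < 2 ^ w" using False u by (auto simp: y_def)
      have y0: "(R(0 := y)) 0 \<in> {2..u}" using y by simp
      obtain \<tau> R' M' where r: "real \<tau> \<le> t" "(R', M') \<in> ?V" "R' 0 = ans ((R(0 := y)) 0)"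
          "\<And>i. N \<le> i \<Longrightarrow> R' i = (R(0 := y)) i"
        and cont: "\<And>t' c''. halts_in w k (clamp P) \<lparr>pc = 4 + length P, regs = R', mem = M'\<rparr> t' c'' \<Longrightarrow>
          halts_in w k (clamp P) (?c 4 y) (\<tau> + t') c''"
        by (rule halts_in_caller[OF V N_def Ccong upd[OF y(2)] y0 code]) (rule that)
      let ?c' = "\<lparr>pc = 4 + l, regs = R', mem = M'\<rparr>"
      have "halts_in w k (clamp P) ?c' 1 ?c'"
        by (rule halts_in.halt) (simp_all add: len nth)
      from cont[folded l_def, OF this] have run4: "halts_in w k (clamp P) (?c 4 y) (\<tau> + 1) ?c'" .
      have "\<exists>\<tau>'\<le>3. halts_in w k (clamp P) (?c 0 x) (\<tau>' + (\<tau> + 1)) ?c'"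
      proof (cases "u < x")
        case True
        have h: "?H (?c 3 x) (Suc (\<tau> + 1)) ?c'"
          by (rule halts_in.step[OF _ _ run4]) (use True RN N0 nth(4) in \<open>auto simp: len y_def\<close>)
        have "?H (?c 0 x) (Suc (Suc (\<tau> + 1))) ?c'"
          by (rule halts_in.step[OF _ _ h]) (use True RN N0 nth(1) in \<open>auto simp: len\<close>)
        then show ?thesis by (intro exI[of _ 2]) auto
      next
        case nless: False
        then have "y = x" by (simp add: y_def)
        then have h: "?H (?c 2 x) (Suc (\<tau> + 1)) ?c'"
          by (intro halts_in.step[OF _ _ run4]) (use nth(3) in \<open>auto simp: len\<close>)
        have h: "?H (?c 1 x) (Suc (Suc (\<tau> + 1))) ?c'"
          by (rule halts_in.step[OF _ _ h])
            (use False RN N0 nth(2) in \<open>auto simp: len numeral_2_eq_2\<close>)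
        have "?H (?c 0 x) (Suc (Suc (Suc (\<tau> + 1)))) ?c'"
          by (rule halts_in.step[OF _ _ h]) (use nless RN N0 nth(1) in \<open>auto simp: len\<close>)
        then show ?thesis by (intro exI[of _ 3]) (auto simp: numeral_3_eq_3)
      qed
      then obtain \<tau>' where "\<tau>' \<le> 3" "halts_in w k (clamp P) (?c 0 x) (\<tau>' + (\<tau> + 1)) ?c'" by blast
      then show ?thesis
        using r False by (intro exI[of _ "\<tau>' + (\<tau> + 1)"] exI[of _ ?c']) (auto simp: y_def)
    qed
  qed
  then show ?thesis by simp
qed

definition difference :: "program \<Rightarrow> program" where
  "difference P = (let N = num_regs P; l = length P in
     [Op Sub (N + 1) 0 N] @ relocate 1 P @
     [Op Or (N + 2) 0 0, Op Or 0 (N + 1) (N + 1)] @ relocate (3 + l) P @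
     [Op Sub 0 (N + 2) 0, Halt])"

lemma eval_Sub: "b \<le> a \<Longrightarrow> a < 2 ^ w \<Longrightarrow> eval_binop w Sub a b = a - b"
proof -
  assume "b \<le> a" "a < 2 ^ w"
  moreover from this have "a + 2 ^ w - b = (a - b) + 2 ^ w" by simp
  ultimately show ?thesis by (simp only: eval_binop.simps mod_add_self2) simp
qed

lemma supports_difference:
  assumes P: "supports w P D ans t s" and w: "1 < (2::nat) ^ w"
    and D': "\<And>x. x \<in> D' \<Longrightarrow> x \<in> D \<and> x - 1 \<in> D \<and> 1 \<le> x \<and> x < 2 ^ w \<and> ans (x - 1) \<le> ans x"
  shows "supports w (difference P) D' (\<lambda>x. ans x - ans (x - 1)) (2 * t + 5) (s + 3)"
proof -
  define N where "N = num_regs P"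
  define l where "l = length P"
  define C where "C R \<longleftrightarrow> R N = 1" for R :: "nat \<Rightarrow> nat"
  have N0: "0 < N" by (simp add: N_def num_regs_pos)
  have code1: "code_at (difference P) 1 P"
    unfolding code_at_def difference_def Let_def by (intro exI conjI, rule refl) simp
  have code2: "code_at (difference P) (3 + l) P"
    unfolding code_at_def difference_def Let_def l_def
    by (rule exI[of _ "[Op Sub (num_regs P + 1) 0 (num_regs P)] @ relocate 1 P @
        [Op Or (num_regs P + 2) 0 0, Op Or 0 (num_regs P + 1) (num_regs P + 1)]"]) simp
  have len: "length (difference P) = 2 * l + 5" by (simp add: difference_def Let_def l_def)
  have nth: "difference P ! 0 = Op Sub (N + 1) 0 N" "difference P ! (1 + l) = Op Or (N + 2) 0 0"
    "difference P ! (2 + l) = Op Or 0 (N + 1) (N + 1)"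
    "difference P ! (3 + l + l) = Op Sub 0 (N + 2) 0" "difference P ! (4 + l + l) = Halt"
    by (simp_all add: difference_def Let_def N_def l_def nth_append nth_Cons')
  have regs: "num_regs (difference P) \<le> N + 3"
    by (rule num_regs_le) (use regs_lt_num_regs[of _ P] N0 in
      \<open>fastforce simp: difference_def Let_def N_def relocate_def subset_iff\<close>)+
  have Ccong: "\<forall>R R'. (\<forall>i\<ge>N. R i = R' i) \<longrightarrow> C R \<longrightarrow> C R'"
    unfolding C_def by force
  have "supports w (difference P) D' (\<lambda>x. ans x - ans (x - 1)) (2 * t + 5) (s + real 3)"
  proof (rule supports_caller[where C = C and E = "\<lambda>_. 1", OF P N_def regs _ _ Ccong])
    show "C (\<lambda>_. 1)" by (simp add: C_def)
    show "1 < (2::nat) ^ w" by (rule w)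
  next
    fix k :: nat and V R M and x :: nat
    let ?V = "caller_states w N V C"
    let ?H = "halts_in w k (difference P)"
    assume V: "answers w k P V D ans t"
      and st: "(R, M) \<in> ?V" and x: "x \<in> D'"
    have state: "R N = 1" "\<And>i. R i < 2 ^ w" if "(R, M) \<in> ?V" for R M
      using that by (auto simp: caller_states_def C_def)
    note x = D'[OF x]
    define R1 where "R1 = R(0 := x, N + 1 := x - 1)"
    have "x - 1 < 2 ^ w" using x by linarith
    then have st1: "(R1, M) \<in> ?V"
      using state[OF st] x N0 by (intro caller_states_update[OF st]) (auto simp: C_def R1_def)
    have R10: "R1 0 \<in> D" using x by (simp add: R1_def)
    obtain \<tau>1 R2 M2 where r2: "real \<tau>1 \<le> t" "(R2, M2) \<in> ?V" "R2 0 = ans (R1 0)"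
        "\<And>i. N \<le> i \<Longrightarrow> R2 i = R1 i"
      and cont1: "\<And>t' c''. ?H \<lparr>pc = 1 + length P, regs = R2, mem = M2\<rparr> t' c'' \<Longrightarrow>
          ?H \<lparr>pc = 1, regs = R1, mem = M\<rparr> (\<tau>1 + t') c''"
      by (rule halts_in_caller[OF V N_def Ccong st1 R10 code1]) (rule that)
    define R3 where "R3 = R2(N + 2 := ans x, 0 := x - 1)"
    have ansx: "R2 0 = ans x" using r2(3) by (simp add: R1_def)
    have ans_w: "ans x < 2 ^ w" using state(2)[OF r2(2), of 0] ansx by simp
    have st3: "(R3, M2) \<in> ?V"
      using state[OF r2(2)] \<open>x - 1 < 2 ^ w\<close> ans_w N0
      by (intro caller_states_update[OF r2(2)]) (auto simp: C_def R3_def)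
    have R30: "R3 0 \<in> D" using x by (simp add: R3_def)
    obtain \<tau>2 R4 M4 where r4: "real \<tau>2 \<le> t" "(R4, M4) \<in> ?V" "R4 0 = ans (R3 0)"
        "\<And>i. N \<le> i \<Longrightarrow> R4 i = R3 i"
      and cont2: "\<And>t' c''. ?H \<lparr>pc = 3 + l + length P, regs = R4, mem = M4\<rparr> t' c'' \<Longrightarrow>
          ?H \<lparr>pc = 3 + l, regs = R3, mem = M2\<rparr> (\<tau>2 + t') c''"
      by (rule halts_in_caller[OF V N_def Ccong st3 R30 code2]) (rule that)
    define R5 where "R5 = R4(0 := ans x - ans (x - 1))"
    have st5: "(R5, M4) \<in> ?V"
      using state[OF r4(2)] ans_w N0
      by (intro caller_states_update[OF r4(2)]) (auto simp: C_def R5_def less_imp_diff_less)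
    let ?c' = "\<lparr>pc = 4 + l + l, regs = R5, mem = M4\<rparr>"
    have h: "?H ?c' 1 ?c'" by (rule halts_in.halt) (use nth(5) in \<open>auto simp: len\<close>)
    have R4: "R4 0 = ans (x - 1)" "R4 (N + 2) = ans x"
      using r4(3,4) N0 by (auto simp: R3_def)
    have h: "?H \<lparr>pc = 3 + l + l, regs = R4, mem = M4\<rparr> (Suc 1) ?c'"
      by (rule halts_in.step[OF _ _ h])
        (use nth(4) R4 x ans_w eval_Sub[of "ans (x - 1)" "ans x" w] in
          \<open>auto simp: len R5_def simp del: eval_binop.simps\<close>)
    have h: "?H \<lparr>pc = 3 + l, regs = R3, mem = M2\<rparr> (\<tau>2 + Suc 1) ?c'"
      by (rule cont2[folded l_def, OF h])
    have "R2 (N + 1) = x - 1" using r2(4) by (simp add: R1_def)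
    then have h: "?H \<lparr>pc = 2 + l, regs = R2(N + 2 := ans x), mem = M2\<rparr> (Suc (\<tau>2 + Suc 1)) ?c'"
      by (intro halts_in.step[OF _ _ h]) (use nth(3) in \<open>auto simp: len R3_def\<close>)
    have h: "?H \<lparr>pc = 1 + l, regs = R2, mem = M2\<rparr> (Suc (Suc (\<tau>2 + Suc 1))) ?c'"
      by (rule halts_in.step[OF _ _ h]) (use nth(2) ansx in \<open>auto simp: len\<close>)
    have h: "?H \<lparr>pc = 1, regs = R1, mem = M\<rparr> (\<tau>1 + Suc (Suc (\<tau>2 + Suc 1))) ?c'"
      by (rule cont1[folded l_def, OF h])
    have "?H \<lparr>pc = 0, regs = R(0 := x), mem = M\<rparr> (Suc (\<tau>1 + Suc (Suc (\<tau>2 + Suc 1)))) ?c'"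
      by (rule halts_in.step[OF _ _ h])
        (use nth(1) x state(1)[OF st] N0 eval_Sub[of 1 x w] in
          \<open>auto simp: len R1_def simp del: eval_binop.simps\<close>)
    then show "\<exists>\<tau> c'. real \<tau> \<le> 2 * t + 5 \<and> ?H \<lparr>pc = 0, regs = R(0 := x), mem = M\<rparr> \<tau> c' \<and>
           regs c' 0 = ans x - ans (x - 1) \<and> (regs c', mem c') \<in> ?V"
      using r2(1) r4(1) st5
      by (intro exI[of _ "Suc (\<tau>1 + Suc (Suc (\<tau>2 + Suc 1)))"] exI[of _ ?c']) (auto simp: R5_def)
  qed
  then show ?thesis by simp
qed

section \<open>The reduction\<close>

lemma logarithmic_word_size_square:
  assumes "logarithmic_word_size W"
  shows "logarithmic_word_size (\<lambda>u. W (2 * u\<^sup>2))"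
  unfolding logarithmic_word_size_def
proof
  have "u \<le> 2 * u\<^sup>2" for u :: nat by (cases u) (auto simp: power2_eq_square)
  then show "\<forall>u. u < 2 ^ W (2 * u\<^sup>2)"
    using assms unfolding logarithmic_word_size_def by (meson le_less_trans)
  have lim: "filterlim (\<lambda>u::nat. 2 * u\<^sup>2) at_top at_top"
    by (rule filterlim_at_top_mono[OF filterlim_ident]) (use \<open>\<And>u. u \<le> 2 * u\<^sup>2\<close> in simp)
  have "(\<lambda>n. real (W n)) \<in> \<Theta>(\<lambda>n. ln (real n))"
    using assms by (simp add: logarithmic_word_size_def)
  then have "(\<lambda>u. real (W (2 * u\<^sup>2))) \<in> \<Theta>(\<lambda>u. ln (real (2 * u\<^sup>2)))"
    using lim by (rule landau_theta.compose)
  also have "(\<lambda>u. ln (real (2 * u\<^sup>2))) \<in> \<Theta>(\<lambda>u. ln (real u))"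
    unfolding of_nat_mult of_nat_power of_nat_numeral by real_asymp
  finally show "(\<lambda>u. real (W (2 * u\<^sup>2))) \<in> \<Theta>(\<lambda>u. ln (real u))" .
qed

lemma supports_predecessor_clamp:
  assumes "supports w P {2..u} (predecessor_word X) t s" "2 \<le> u" "u < 2 ^ w" "X \<subseteq> {2..u}"
  shows "supports_predecessor_queries w (clamp P) X (t + 4) (s + 2)"
  unfolding supports_predecessor_queries_def
proof (rule supports_weaken[OF supports_clamp[OF assms(1-3)]])
  fix x
  have "{y \<in> X. y \<le> min x u} = {y \<in> X. y \<le> x}" using assms(4) by auto
  then have "predecessor_word X (min x u) = predecessor_word X x"
    unfolding predecessor_word_def predecessor_def by (simp only:)
  moreover have "predecessor_word X x = 0" if "x < 2"
  proof -
    have "{y \<in> X. y \<le> x} = {}" using assms(4) that by fastforce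
    then show ?thesis by (simp add: predecessor_word_def predecessor_def)
  qed
  ultimately show "(if x < 2 then 0 else predecessor_word X (min x u)) = predecessor_word X x"
    by auto
qed simp_all

theorem theorem2:
  shows "\<exists>C::real. C > 0 \<and>
    (\<forall>(W :: nat \<Rightarrow> nat) (P :: program)
       (f_t :: nat \<Rightarrow> nat \<Rightarrow> nat \<Rightarrow> real) (f_s :: nat \<Rightarrow> nat \<Rightarrow> nat \<Rightarrow> real).
       logarithmic_word_size W \<and>
       (\<forall>n q. mono (f_t n q)) \<and> (\<forall>n q. mono (f_s n q)) \<and>
       (supports_count_queries lmco W P f_t f_s \<or> supports_count_queries co W P f_t f_s)
       \<longrightarrow>
       logarithmic_word_size (\<lambda>u. W (2 * u\<^sup>2)) \<and>
       (\<exists>P' :: program. \<forall>(u::nat) (X :: nat set) (m::nat).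
          2 \<le> u \<and> X \<subseteq> {2..u} \<and> card X = m \<longrightarrow>
          supports_predecessor_queries (W (2 * u\<^sup>2)) P' X
            (C * f_t (2 * u\<^sup>2) 2 (8 * m))
            (C * f_s (2 * u\<^sup>2) 2 (8 * m))))"
proof (intro exI[of _ "11::real"] conjI allI impI)
  fix W P f_t f_s
  assume asm: "logarithmic_word_size W \<and>
       (\<forall>n q. mono (f_t n q)) \<and> (\<forall>n q. mono (f_s n q)) \<and>
       (supports_count_queries lmco W P f_t f_s \<or> supports_count_queries co W P f_t f_s)"
  then show log: "logarithmic_word_size (\<lambda>u. W (2 * u\<^sup>2))"
    using logarithmic_word_size_square by blast
  define T where "T u X = f_t (2 * u\<^sup>2) 2 (8 * card X)" for u :: nat and X :: "nat set"
  define Sp where "Sp u X = f_s (2 * u\<^sup>2) 2 (8 * card X)" for u :: nat and X :: "nat set"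
  have u_word: "u < 2 ^ W (2 * u\<^sup>2)" for u using log by (simp add: logarithmic_word_size_def)
  have n_le: "{2..u} \<subseteq> {1..2 * u\<^sup>2}" for u :: nat
  proof -
    have "u \<le> 2 * u\<^sup>2" by (cases u) (auto simp: power2_eq_square)
    then show ?thesis by auto
  qed
  have inst: "supports (W (2 * u\<^sup>2)) P {1..2 * u\<^sup>2} (F S Q) (T u X) (Sp u X)"
    if "supports_count_queries F W P f_t f_s" "length S = 2 * u\<^sup>2" "finite Q" "card Q = 2"
      "d_param S Q \<le> 8 * card X" for F S Q and u :: nat and X
  proof -
    have "supports (W (2 * u\<^sup>2)) P {1..2 * u\<^sup>2} (F S Q)
        (f_t (2 * u\<^sup>2) 2 (d_param S Q)) (f_s (2 * u\<^sup>2) 2 (d_param S Q))"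
      using that unfolding supports_count_queries_def by (metis order_refl)
    then show ?thesis
      by (rule supports_weaken) (use asm that in \<open>auto simp: T_def Sp_def intro: monoD\<close>)
  qed
  have finish: "supports_predecessor_queries (W (2 * u\<^sup>2)) P' X (11 * T u X) (11 * Sp u X)"
    if "supports_predecessor_queries (W (2 * u\<^sup>2)) P' X t s" "t \<le> 2 * T u X + 9" "s \<le> Sp u X + 5"
      "1 \<le> T u X" "1 \<le> Sp u X" for P' X t s and u :: nat
    using that(1) unfolding supports_predecessor_queries_def
    by (rule supports_weaken) (use that in auto)
  have "\<exists>P'. \<forall>u X. 2 \<le> u \<and> X \<subseteq> {2..u} \<longrightarrow>
      supports_predecessor_queries (W (2 * u\<^sup>2)) P' X (11 * T u X) (11 * Sp u X)"
    using asm
  proof (elim conjE disjE)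
    assume count: "supports_count_queries lmco W P f_t f_s"
    show ?thesis
    proof (intro exI allI impI)
      fix u :: nat and X assume uX: "2 \<le> u \<and> X \<subseteq> {2..u}"
      then obtain S :: "nat list" and Q :: "nat set" where
        S: "length S = 2 * u\<^sup>2" "finite Q" "card Q = 2" "d_param S Q \<le> 8 * card X"
        and lmco: "\<And>x. x \<le> u \<Longrightarrow> lmco S Q x = predecessor_word X x"
        using predecessor_string by metis
      note sup = inst[OF count S]
      have "supports (W (2 * u\<^sup>2)) P {2..u} (predecessor_word X) (T u X) (Sp u X)"
        by (rule supports_weaken[OF sup _ _ n_le]) (use lmco in auto)
      from supports_predecessor_clamp[OF this _ u_word] uX
      have "supports_predecessor_queries (W (2 * u\<^sup>2)) (clamp P) X (T u X + 4) (Sp u X + 2)" by simp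
      moreover have "1 \<le> T u X" "1 \<le> Sp u X" using supports_bounds[OF sup] uX by auto
      ultimately show "supports_predecessor_queries (W (2 * u\<^sup>2)) (clamp P) X (11 * T u X) (11 * Sp u X)"
        by (intro finish) auto
    qed
  next
    assume count: "supports_count_queries co W P f_t f_s"
    show ?thesis
    proof (intro exI allI impI)
      fix u :: nat and X assume uX: "2 \<le> u \<and> X \<subseteq> {2..u}"
      then obtain S :: "nat list" and Q :: "nat set" where
        S: "length S = 2 * u\<^sup>2" "finite Q" "card Q = 2" "d_param S Q \<le> 8 * card X"
        and lmco: "\<And>x. x \<le> u \<Longrightarrow> lmco S Q x = predecessor_word X x"
        and co: "\<And>x. 2 \<le> x \<Longrightarrow> x \<le> u \<Longrightarrow> co S Q x = lmco S Q x + co S Q (x - 1)"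
        using predecessor_string by metis
      note sup = inst[OF count S]
      have "supports (W (2 * u\<^sup>2)) (difference P) {2..u} (\<lambda>x. co S Q x - co S Q (x - 1))
          (2 * T u X + 5) (Sp u X + 3)"
      proof (rule supports_difference[OF sup])
        show "1 < (2::nat) ^ W (2 * u\<^sup>2)" using u_word[of u] uX by linarith
        fix x assume "x \<in> {2..u}"
        then show "x \<in> {1..2 * u\<^sup>2} \<and> x - 1 \<in> {1..2 * u\<^sup>2} \<and> 1 \<le> x \<and> x < 2 ^ W (2 * u\<^sup>2) \<and>
            co S Q (x - 1) \<le> co S Q x"
          using n_le[of u] u_word[of u] co[of x] by fastforce
      qed
      then have "supports (W (2 * u\<^sup>2)) (difference P) {2..u} (predecessor_word X)
          (2 * T u X + 5) (Sp u X + 3)"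
        by (rule supports_weaken) (use lmco co in auto)
      from supports_predecessor_clamp[OF this _ u_word] uX
      have "supports_predecessor_queries (W (2 * u\<^sup>2)) (clamp (difference P)) X
          (2 * T u X + 9) (Sp u X + 5)" by (simp add: add.assoc)
      moreover have "1 \<le> T u X" "1 \<le> Sp u X" using supports_bounds[OF sup] uX by auto
      ultimately show "supports_predecessor_queries (W (2 * u\<^sup>2)) (clamp (difference P)) X
          (11 * T u X) (11 * Sp u X)"
        by (intro finish) auto
    qed
  qed
  then show "\<exists>P' :: program. \<forall>(u::nat) (X :: nat set) (m::nat).
          2 \<le> u \<and> X \<subseteq> {2..u} \<and> card X = m \<longrightarrow>
          supports_predecessor_queries (W (2 * u\<^sup>2)) P' X
            (11 * f_t (2 * u\<^sup>2) 2 (8 * m))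
            (11 * f_s (2 * u\<^sup>2) 2 (8 * m))"
    by (auto simp: T_def Sp_def)
qed simp

end
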